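(* Let $X$ be a zero-dimensional Hausdorff $P$-space and let $A_c(X)$ be a ring with $C_c^*(X)\subseteq A_c(X)\subseteq C_c(X)$. Then $A_c(X)$ is von Neumann regular if and only if $A_c(X)=C_c(X)$.
   Context: A space is zero-dimensional if its clopen sets form a base for its topology. A (Tychonoff) space is a $P$-space if every $G_\delta$-set in it is open. $C_c(X)$ is the ring of real-valued continuous functions on $X$ with countable range, and $C_c^*(X)$ is the subring of bounded members of $C_c(X)$. *)

theory Defs
  imports "HOL-Analysis.Analysis" "HOL-Algebra.Subrings"
begin

definition zero_dimensional_space :: "'a topology \<Rightarrow> bool" where
  "zero_dimensional_space X \<longleftrightarrow>
     (\<forall>U x. openin X U \<and> x \<in> U \<longrightarrow>
        (\<exists>V. openin X V \<and> closedin X V \<and> x \<in> V \<and> V \<subseteq> U))"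

text \<open>P-spaces are Tychonoff by convention. For zero-dimensional Hausdorff spaces
  the first two conjuncts hold automatically.\<close>

definition P_space :: "'a topology \<Rightarrow> bool" where
  "P_space X \<longleftrightarrow> completely_regular_space X \<and> Hausdorff_space X \<and>
     (\<forall>S. gdelta_in X S \<longrightarrow> openin X S)"

text \<open>A real-valued function on the space \<^term>\<open>X\<close> is represented by its unique extension to the
  whole type that has the value \<^term>\<open>undefined\<close> outside \<^term>\<open>topspace X\<close>. This makes equality
  of functions on \<^term>\<open>X\<close> the equality of HOL.\<close>

definition Cc :: "'a topology \<Rightarrow> ('a \<Rightarrow> real) set" where
  "Cc X = {f \<in> extensional (topspace X).
             continuous_map X euclideanreal f \<and> countable (f ` topspace X)}"

definition Cc_bounded :: "'a topology \<Rightarrow> ('a \<Rightarrow> real) set" where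
  "Cc_bounded X = {f \<in> Cc X. bounded (f ` topspace X)}"

definition Cc_ring :: "'a topology \<Rightarrow> ('a \<Rightarrow> real) ring" where
  "Cc_ring X = \<lparr>carrier = Cc X,
     mult = (\<lambda>f g. \<lambda>x\<in>topspace X. f x * g x),
     one = (\<lambda>x\<in>topspace X. 1),
     zero = (\<lambda>x\<in>topspace X. 0),
     add = (\<lambda>f g. \<lambda>x\<in>topspace X. f x + g x)\<rparr>"

definition von_neumann_regular :: "('a, 'b) ring_scheme \<Rightarrow> bool" where
  "von_neumann_regular R \<longleftrightarrow> ring R \<and>
     (\<forall>a\<in>carrier R. \<exists>b\<in>carrier R. a = a \<otimes>\<^bsub>R\<^esub> b \<otimes>\<^bsub>R\<^esub> a)"

end

theory Submission
  imports Defs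
begin

text \<open>In a P-space every fibre of a continuous real function is a G-delta, hence open. So the
  composition of a continuous \<open>f\<close> with \<^emph>\<open>any\<close> real function is continuous, and
  \<open>inverse \<circ> f\<close> is a quasi-inverse of \<open>f\<close> in the full ring. Conversely, every \<open>f\<close> factors as
  \<open>f / (1 + \<bar>f\<bar>)\<close> times \<open>1 + \<bar>f\<bar>\<close>: the first factor is bounded, and the second one is
  the only quasi-inverse of the bounded, nowhere vanishing function \<open>1 / (1 + \<bar>f\<bar>)\<close>.\<close>

text \<open>The new range lies in the image of a product of two countable ranges. Continuity is
  asked of the combined function and not of \<open>h\<close>, so that \<open>h\<close> may be
  discontinuous, like \<open>inverse\<close>. Unary operations are covered by an \<open>h\<close>
  that ignores one argument.\<close>

lemma Cc_binop:
  assumes f: "f \<in> Cc X" and g: "g \<in> Cc X"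
    and h: "continuous_map X euclideanreal (\<lambda>x. h (f x) (g x))"
  shows "(\<lambda>x\<in>topspace X. h (f x) (g x)) \<in> Cc X"
proof -
  have "countable ((\<lambda>(u, v). h u v) ` (f ` topspace X \<times> g ` topspace X))"
    using f g by (auto simp: Cc_def)
  then have "countable ((\<lambda>x. h (f x) (g x)) ` topspace X)"
    by (rule countable_subset[rotated]) auto
  then show ?thesis
    using h by (auto simp: Cc_def intro: continuous_map_eq)
qed

lemma ring_Cc_ring: "ring (Cc_ring X)"
proof (intro ringI abelian_groupI monoidI)
  have const: "(\<lambda>x\<in>topspace X. c) \<in> Cc X" for c
    by (auto simp: Cc_def image_constant_conv intro: continuous_map_eq[of _ _ "\<lambda>x. c"])
  show "\<zero>\<^bsub>Cc_ring X\<^esub> \<in> carrier (Cc_ring X)" "\<one>\<^bsub>Cc_ring X\<^esub> \<in> carrier (Cc_ring X)"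
    using const by (simp_all add: Cc_ring_def)
  fix f g assume fg: "f \<in> carrier (Cc_ring X)" "g \<in> carrier (Cc_ring X)"
  then have cont: "continuous_map X euclideanreal f" "continuous_map X euclideanreal g"
    by (auto simp: Cc_ring_def Cc_def)
  show "f \<oplus>\<^bsub>Cc_ring X\<^esub> g \<in> carrier (Cc_ring X)" "f \<otimes>\<^bsub>Cc_ring X\<^esub> g \<in> carrier (Cc_ring X)"
    using fg cont Cc_binop[of f X g "(+)"] Cc_binop[of f X g "(*)"]
    by (simp_all add: Cc_ring_def continuous_map_add continuous_map_real_mult)
next
  fix f assume f: "f \<in> carrier (Cc_ring X)"
  then have cont: "continuous_map X euclideanreal f" by (simp add: Cc_ring_def Cc_def)
  have "(\<lambda>x\<in>topspace X. - f x) \<in> Cc X"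
    using f Cc_binop[of f X f "\<lambda>u v. - u"] cont
    by (auto simp: Cc_ring_def intro!: continuous_intros)
  then show "\<exists>g\<in>carrier (Cc_ring X). g \<oplus>\<^bsub>Cc_ring X\<^esub> f = \<zero>\<^bsub>Cc_ring X\<^esub>"
    by (intro bexI[of _ "\<lambda>x\<in>topspace X. - f x"]) (auto simp: Cc_ring_def)
qed (auto simp: Cc_ring_def Cc_def fun_eq_iff restrict_def extensional_def algebra_simps)

lemma P_space_continuous_map_compose_any:
  fixes f :: "'a \<Rightarrow> real" and h :: "real \<Rightarrow> real"
  assumes P: "P_space X" and f: "continuous_map X euclideanreal f"
  shows "continuous_map X euclideanreal (\<lambda>x. h (f x))"
proof -
  have fibre: "openin X {x \<in> topspace X. f x \<in> {c}}" for c
  proof -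
    \<comment> \<open>With \<open>Suc n\<close> every radius is positive;
      \<open>inverse 0 = 0\<close> would give an empty ball.\<close>
    let ?U = "\<lambda>n. {x \<in> topspace X. f x \<in> ball c (inverse (real (Suc n)))}"
    have "gdelta_in X (?U n)" for n
      using openin_continuous_map_preimage[OF f, of "ball c (inverse (real (Suc n)))"]
      by (intro open_imp_gdelta_in) simp
    then have "gdelta_in X (\<Inter>n. ?U n)"
      by (intro gdelta_in_Inter) auto
    moreover have "(\<Inter>n. ?U n) = {x \<in> topspace X. f x \<in> {c}}"
    proof -
      \<comment> \<open>Were \<open>dist c u\<close> positive, some
        \<open>inverse (real (Suc n))\<close> would lie below it.\<close>
      have "u = c" if "\<And>n. dist c u < inverse (real (Suc n))" for u
        using that reals_Archimedean[of "dist c u"] by (metis less_asym zero_less_dist_iff)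
      then show ?thesis
        by (auto simp: ball_def)
    qed
    ultimately show ?thesis
      using P by (simp add: P_space_def)
  qed
  have "openin X {x \<in> topspace X. h (f x) \<in> U}" for U
  proof -
    \<comment> \<open>The preimage of any set of reals is a union of fibres of \<open>f\<close>, all
      of them open.\<close>
    have "{x \<in> topspace X. h (f x) \<in> U} = (\<Union>c\<in>h -` U. {x \<in> topspace X. f x \<in> {c}})"
      by auto
    also have "openin X \<dots>"
      using fibre by blast
    finally show ?thesis .
  qed
  then show ?thesis
    by (simp add: continuous_map_def)
qed

theorem theorem3p17:
  fixes X :: "'a topology" and A :: "('a \<Rightarrow> real) set"
  assumes "zero_dimensional_space X" and "Hausdorff_space X" and "P_space X"
    and "subring A (Cc_ring X)"
    and "Cc_bounded X \<subseteq> A" and "A \<subseteq> Cc X"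
  shows "von_neumann_regular ((Cc_ring X)\<lparr>carrier := A\<rparr>) \<longleftrightarrow> A = Cc X"
proof
  assume reg: "von_neumann_regular ((Cc_ring X)\<lparr>carrier := A\<rparr>)"
  have "f \<in> A" if f: "f \<in> Cc X" for f
  proof -
    \<comment> \<open>Both functions are bounded by 1, hence in \<open>A\<close>, and
      \<open>f\<close> is \<open>k\<close> divided by \<open>g\<close>. So it remains to find
      \<open>1 / g\<close> in \<open>A\<close>.\<close>
    define g where "g = (\<lambda>x\<in>topspace X. 1 / (1 + \<bar>f x\<bar>))"
    define k where "k = (\<lambda>x\<in>topspace X. f x / (1 + \<bar>f x\<bar>))"
    have pos: "1 + \<bar>u\<bar> > 0" "1 + \<bar>u\<bar> \<noteq> 0" for u :: real
      by linarith+
    have cont: "continuous_map X euclideanreal f"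
      using f by (simp add: Cc_def)
    have "g \<in> Cc X"
      unfolding g_def
      by (rule Cc_binop[OF f f, of "\<lambda>u v. 1 / (1 + \<bar>u\<bar>)"])
        (auto intro!: continuous_intros cont simp: pos)
    moreover have "k \<in> Cc X"
      unfolding k_def
      by (rule Cc_binop[OF f f, of "\<lambda>u v. u / (1 + \<bar>u\<bar>)"])
        (auto intro!: continuous_intros cont simp: pos)
    moreover have "\<bar>g x\<bar> \<le> 1" "\<bar>k x\<bar> \<le> 1" if "x \<in> topspace X" for x
      using that by (auto simp: g_def k_def)
    ultimately have gk: "g \<in> A" "k \<in> A"
      using assms(5) by (fastforce simp: Cc_bounded_def bounded_iff)+
    with reg obtain b where b: "b \<in> A"
      and gbg: "g = (\<lambda>x\<in>topspace X. (\<lambda>x\<in>topspace X. g x * b x) x * g x)"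
      by (auto simp: von_neumann_regular_def Cc_ring_def)
    have b_eq: "b x = 1 + \<bar>f x\<bar>" if x: "x \<in> topspace X" for x
    proof -
      \<comment> \<open>As \<open>g x\<close> is nonzero, cancelling it leaves
        \<open>b x * g x = 1\<close>.\<close>
      have "g x = g x * b x * g x"
        using fun_cong[OF gbg, of x] unfolding restrict_apply'[OF x] .
      moreover have "g x \<noteq> 0"
        using x pos[of "f x"] by (simp add: g_def)
      ultimately have "b x = 1 / g x"
        by (simp add: field_simps)
      then show ?thesis
        using x by (simp add: g_def)
    qed
    \<comment> \<open>Outside \<open>topspace X\<close> both sides are \<open>undefined\<close>,
      since \<open>f\<close> is extensional.\<close>
    have "(\<lambda>x\<in>topspace X. k x * b x) = f"
      using f pos by (auto simp: fun_eq_iff k_def b_eq Cc_def extensional_def)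
    moreover have "(\<lambda>x\<in>topspace X. k x * b x) \<in> A"
      using subringE(6)[OF assms(4) gk(2) b] by (simp add: Cc_ring_def)
    ultimately show ?thesis
      by simp
  qed
  with assms(6) show "A = Cc X" by auto
next
  assume A: "A = Cc X"
  have "\<exists>b\<in>Cc X. f = f \<otimes>\<^bsub>Cc_ring X\<^esub> b \<otimes>\<^bsub>Cc_ring X\<^esub> f" if f: "f \<in> Cc X" for f
  proof
    show "(\<lambda>x\<in>topspace X. inverse (f x)) \<in> Cc X"
      \<comment> \<open>\<open>inverse\<close> is discontinuous at 0, so continuity at the zeros of
        \<open>f\<close> comes from the P-space property.\<close>
      using f P_space_continuous_map_compose_any[OF assms(3)]
      by (intro Cc_binop[OF f f, of "\<lambda>u v. inverse u"]) (simp add: Cc_def)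
    \<comment> \<open>Zeros of \<open>f\<close> need no separate treatment because \<open>inverse 0 = 0\<close>.\<close>
    show "f = f \<otimes>\<^bsub>Cc_ring X\<^esub> (\<lambda>x\<in>topspace X. inverse (f x)) \<otimes>\<^bsub>Cc_ring X\<^esub> f"
      using f by (auto simp: Cc_ring_def Cc_def fun_eq_iff extensional_def intro: ccontr dest: right_inverse)
  qed
  moreover have "(Cc_ring X)\<lparr>carrier := A\<rparr> = Cc_ring X"
    by (simp add: A Cc_ring_def)
  ultimately show "von_neumann_regular ((Cc_ring X)\<lparr>carrier := A\<rparr>)"
    using ring_Cc_ring[of X] by (simp add: von_neumann_regular_def) (simp add: Cc_ring_def)
qed

end
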